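(* Let $n\ge1$, let $U,V\subset\mathbb{R}^n$ be $0$-symmetric closed convex bodies, and put $H:=\tfrac12U$. Then $$C_n(U,V)\le 2^n\,\frac{|V+U|}{|V|}\,\theta(H).$$ In particular, for every real $r\ge1$, $$C_n(U,rU)\le 2^n(1+r^{-1})^n\,\theta(H).$$
   Context: A convex body is a compact convex set with nonempty interior; it is $0$-symmetric if $A=-A$. $A+B$ denotes the Minkowski sum and $\lambda A=\{\lambda a: a\in A\}$. $|A|$ denotes the volume (Lebesgue measure) of $A$, or the cardinality of $A$ if $A$ is a finite set. A continuous function $f:\mathbb{R}^n\to\mathbb{C}$ is positive definite if for every finite $Y\subset\mathbb{R}^n$ and all complex numbers $\{c_a: a\in Y\}$ one has $\sum_{a,b\in Y}c_a\overline{c_b}f(a-b)\ge 0$. A double positive definite function, written $f\succeq 0$, is a continuous positive definite function $f$ on $\mathbb{R}^n$ with values in $\mathbb{R}_+=[0,\infty)$. For $0$-symmetric closed convex bodies $U,V\subset\mathbb{R}^n$, $$C_n(U,V):=\sup_{f\succeq 0,\ f\ne 0}\frac{\frac{1}{|V|}\int_V f(x)\,dx}{\frac{1}{|U|}\int_U f(x)\,dx}.$$ Covering density: for a convex body $H$ and a discrete set $X\subset\mathbb{R}^n$ with $\mathbb{R}^n\subseteq H+X$, the covering density $\theta(H,X)$ of $\mathbb{R}^n$ by the translates $H+a$, $a\in X$, is the number such that $|X\cap A|\,|H|/|A|=\theta(H,X)(1+o(1))$ for convex bodies $A$ whose inradius tends to infinity. Then $\theta(H):=\inf_X\theta(H,X)$,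 the infimum over all discrete sets $X\subset\mathbb{R}^n$ with $\mathbb{R}^n\subseteq H+X$ that have such a density. *)

theory Defs
  imports "HOL-Analysis.Analysis" "HOL-Library.Landau_Symbols" "HOL-Library.Set_Algebras"
begin

definition convex_body :: "'a::euclidean_space set \<Rightarrow> bool" where
  "convex_body A \<longleftrightarrow> compact A \<and> convex A \<and> interior A \<noteq> {}"

definition zero_symmetric :: "'a::euclidean_space set \<Rightarrow> bool" where
  "zero_symmetric A \<longleftrightarrow> A = uminus ` A"

abbreviation vol :: "'a::euclidean_space set \<Rightarrow> real" where
  "vol A \<equiv> measure lebesgue A"

definition dilate :: "real \<Rightarrow> 'a::euclidean_space set \<Rightarrow> 'a set" where
  "dilate c A = (\<lambda>a. c *\<^sub>R a) ` A"

definition positive_definite :: "('a::euclidean_space \<Rightarrow> complex) \<Rightarrow> bool" where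
  "positive_definite f \<longleftrightarrow> continuous_on UNIV f \<and>
     (\<forall>Y c. finite Y \<longrightarrow>
       (\<Sum>a\<in>Y. \<Sum>b\<in>Y. c a * cnj (c b) * f (a - b)) \<in> \<real>\<^sub>\<ge>\<^sub>0)"

definition double_positive_definite :: "('a::euclidean_space \<Rightarrow> real) \<Rightarrow> bool" where
  "double_positive_definite f \<longleftrightarrow>
     positive_definite (\<lambda>x. complex_of_real (f x)) \<and> (\<forall>x. 0 \<le> f x)"

text \<open>The supremum is taken in the extended reals, so finiteness is not presupposed.
  For 0-symmetric convex bodies every denominator below is positive: a nonzero
  double positive definite function is continuous and positive at the interior point 0.\<close>

definition wiener_const :: "'a::euclidean_space set \<Rightarrow> 'a set \<Rightarrow> ereal" where
  "wiener_const U V =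
     (SUP f \<in> {f. double_positive_definite f \<and> f \<noteq> (\<lambda>x. 0)}.
        ereal ((1 / vol V * (LINT x:V|lebesgue. f x)) /
               (1 / vol U * (LINT x:U|lebesgue. f x))))"

definition inradius :: "'a::euclidean_space set \<Rightarrow> real" where
  "inradius A = Sup {r. 0 \<le> r \<and> (\<exists>x. cball x r \<subseteq> A)}"

definition large_convex_bodies :: "'a::euclidean_space set filter" where
  "large_convex_bodies = inf (filtercomap inradius at_top) (principal {A. convex_body A})"

text \<open>\<open>has_covering_density H X d\<close> says that the translates of \<open>H\<close> by the points of \<open>X\<close>
  cover the space with density \<open>d\<close>. The relation \<open>f \<sim>[F] (\<lambda>_. d)\<close> is
  \<open>f = d * (1 + o(1))\<close> along \<open>F\<close>. The finiteness condition is needed because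
  \<^const>\<open>card\<close> is 0 on infinite sets.\<close>

definition has_covering_density ::
    "'a::euclidean_space set \<Rightarrow> 'a set \<Rightarrow> real \<Rightarrow> bool" where
  "has_covering_density H X d \<longleftrightarrow>
     discrete X \<and> UNIV \<subseteq> H + X \<and>
     (\<forall>\<^sub>F A in large_convex_bodies. finite (X \<inter> A)) \<and>
     (\<lambda>A. real (card (X \<inter> A)) * vol H / vol A) \<sim>[large_convex_bodies] (\<lambda>_. d)"

definition min_covering_density :: "'a::euclidean_space set \<Rightarrow> ereal" where
  "min_covering_density H = Inf {ereal d | X d. has_covering_density H X d}"

end

theory Submission
  imports Defs
begin

text \<open>
  Write \<open>\<Phi>(a)\<close> for the integral of \<open>f(s - t)\<close> over \<open>s \<in> H + a\<close>, \<open>t \<in> H\<close>; this is the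
  \<open>pair_mass\<close> of \<open>a + H\<close> and \<open>H\<close>. As a function of \<open>a\<close> it is again positive definite, so
  \<open>\<Phi>(a) \<le> \<Phi>(0)\<close>; concretely, the quadratic form of \<open>f\<close> is nonnegative at the signed
  density \<open>1\<^sub>H - 1\<^bsub>H+a\<^esub>\<close> (lemma \<open>pair_mass_translate_le\<close>). Since \<open>H - H = U\<close> and
  \<open>f \<ge> 0\<close>, moreover \<open>\<Phi>(0) \<le> |H| \<integral>\<^sub>U f\<close>.

  Suppose that \<open>\<real>\<^sup>n = H + X\<close>. For each \<open>t \<in> H\<close> the sets \<open>H + a - t\<close> with
  \<open>a \<in> X \<inter> (V + U)\<close> cover \<open>V\<close>. Summing the slices over \<open>a\<close> and integrating over \<open>t\<close> gives
  \<open>|H| \<integral>\<^sub>V f \<le> \<Sum>\<^sub>a \<Phi>(a) \<le> |X \<inter> (V + U)| \<Phi>(0)\<close>, and therefore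
  \<open>\<integral>\<^sub>V f \<le> |X \<inter> (V + U)| \<integral>\<^sub>U f\<close> (lemma \<open>integral_le_card_mult_integral\<close>).

  The same holds for every translate \<open>X + \<tau>\<close>. Averaging the cardinality over \<open>\<tau>\<close> in a large ball
  replaces it by its mean value \<open>\<theta>(H,X) |V + U| / |H|\<close> (lemmas \<open>integral_le_average\<close> and
  \<open>integral_le_covering_density\<close>). As \<open>|H| = |U| / 2\<^sup>n\<close>, dividing by \<open>|V|\<close> and taking the
  infimum over \<open>X\<close> yields the bound. For \<open>V = r U\<close> convexity gives \<open>V + U = (1 + r) U\<close>.
\<close>

section \<open>Finite quadratic forms of a double positive definite function\<close>

lemma double_positive_definite_continuous:
  assumes "double_positive_definite f"
  shows "continuous_on UNIV f"
proof -
  have "continuous_on UNIV (\<lambda>x. Re (complex_of_real (f x)))"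
    using assms unfolding double_positive_definite_def positive_definite_def
    by (intro continuous_on_Re) auto
  then show ?thesis by simp
qed

lemma double_positive_definite_sum_nonneg:
  assumes "double_positive_definite f" "finite Y"
  shows "(\<Sum>a\<in>Y. \<Sum>b\<in>Y. c a * cnj (c b) * complex_of_real (f (a - b))) \<in> \<real>\<^sub>\<ge>\<^sub>0"
  using assms by (simp add: double_positive_definite_def positive_definite_def)

lemma double_positive_definite_quadratic_form:
  assumes "double_positive_definite f" "finite Y"
  shows "0 \<le> (\<Sum>a\<in>Y. \<Sum>b\<in>Y. c a * c b * f (a - b))"
proof -
  have "(\<Sum>a\<in>Y. \<Sum>b\<in>Y. complex_of_real (c a) * cnj (complex_of_real (c b)) *
      complex_of_real (f (a - b))) = complex_of_real (\<Sum>a\<in>Y. \<Sum>b\<in>Y. c a * c b * f (a - b))"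
    by simp
  with double_positive_definite_sum_nonneg[OF assms, of "\<lambda>a. complex_of_real (c a)"]
  show ?thesis
    by (simp only: nonneg_Reals_of_real_iff)
qed

text \<open>A positive definite function is Hermitian, and here it is real. The identity is the vanishing
  imaginary part of the form on \<open>{0, x}\<close> with coefficients \<open>1\<close> and \<open>\<i>\<close>.\<close>

lemma double_positive_definite_even:
  assumes "double_positive_definite f"
  shows "f (- x) = f x"
proof (cases "x = 0")
  case False
  define c where "c a = (if a = 0 then 1 else \<i>)" for a :: 'a
  have "(\<Sum>a\<in>{0,x}. \<Sum>b\<in>{0,x}. c a * cnj (c b) * complex_of_real (f (a - b))) \<in> \<real>\<^sub>\<ge>\<^sub>0"
    by (rule double_positive_definite_sum_nonneg[OF assms]) simp
  then have "Im (\<Sum>a\<in>{0,x}. \<Sum>b\<in>{0,x}. c a * cnj (c b) * complex_of_real (f (a - b))) = 0"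
    by (simp only: complex_nonneg_Reals_iff)
  then show ?thesis
    using False by (simp add: c_def)
qed simp

section \<open>Quadratic forms of integrable densities\<close>

lemma integrable_product_continuous:
  fixes h :: "'a::euclidean_space \<times> 'a \<Rightarrow> real"
  assumes "continuous_on UNIV h" "compact P" "compact Q"
  shows "integrable (lborel \<Otimes>\<^sub>M lborel) (\<lambda>z. indicator P (fst z) * indicator Q (snd z) * h z)"
proof -
  have "integrable lborel (\<lambda>z. indicator (P \<times> Q) z *\<^sub>R h z)"
    using assms by (intro borel_integrable_compact compact_Times continuous_on_subset[OF assms(1)]) auto
  then show ?thesis
    by (simp add: lborel_prod indicator_times)
qed

lemma integral_product_mult:
  fixes u v :: "'a::euclidean_space \<Rightarrow> real"
  assumes "integrable lborel u" "integrable lborel v"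
  shows "integrable (lborel \<Otimes>\<^sub>M lborel) (\<lambda>z. u (fst z) * v (snd z))"
    and "(\<integral>z. u (fst z) * v (snd z) \<partial>(lborel \<Otimes>\<^sub>M lborel)) = integral\<^sup>L lborel u * integral\<^sup>L lborel v"
proof -
  have [measurable]: "u \<in> borel_measurable borel" "v \<in> borel_measurable borel"
    using assms by (auto dest: borel_measurable_integrable)
  show *: "integrable (lborel \<Otimes>\<^sub>M lborel) (\<lambda>z. u (fst z) * v (snd z))"
  proof (rule lborel_pair.Fubini_integrable)
    show "(\<lambda>z. u (fst z) * v (snd z)) \<in> borel_measurable (lborel \<Otimes>\<^sub>M lborel)"
      by measurable
  qed (use assms in \<open>auto simp: abs_mult\<close>)
  show "(\<integral>z. u (fst z) * v (snd z) \<partial>(lborel \<Otimes>\<^sub>M lborel)) = integral\<^sup>L lborel u * integral\<^sup>L lborel v"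
    using lborel_pair.integral_fst'[OF *] by simp
qed

text \<open>Replacing the identity map by a simple function \<open>g\<close> turns \<open>f(s - t)\<close> into
  \<open>f(g s - g t)\<close>, and the double integral into a finite quadratic form of \<open>f\<close> on the range of \<open>g\<close>,
  whose coefficients are the integrals of \<open>w\<close> over the fibres of \<open>g\<close>. Simple functions converging
  to the identity then give the claim by dominated convergence; the bounded support of \<open>w\<close> keeps the
  arguments of \<open>f\<close> in a fixed compact ball.\<close>

lemma integral_quadratic_form_nonneg:
  fixes f :: "'a::euclidean_space \<Rightarrow> real"
  assumes f: "double_positive_definite f" and w: "integrable lborel w"
    and R: "\<And>x. R < norm x \<Longrightarrow> w x = 0"
  shows "0 \<le> (\<integral>z. w (fst z) * w (snd z) * f (fst z - snd z) \<partial>(lborel \<Otimes>\<^sub>M lborel))"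
proof -
  have cont: "continuous_on UNIV f" by (rule double_positive_definite_continuous[OF f])
  have [measurable]: "f \<in> borel_measurable borel" using cont by (rule borel_measurable_continuous_onI)
  have wm[measurable]: "w \<in> borel_measurable borel" using w by (auto dest: borel_measurable_integrable)
  from borel_measurable_implies_sequence_metric[of "\<lambda>x. x" lborel "0::'a"]
  obtain g :: "nat \<Rightarrow> 'a \<Rightarrow> 'a" where
    g: "\<And>k. simple_function lborel (g k)" "\<And>x. (\<lambda>k. g k x) \<longlonglongrightarrow> x"
       "\<And>k x. norm (g k x) \<le> 2 * norm x"
    by (auto simp: dist_norm)
  have gm[measurable]: "g k \<in> borel_measurable borel" for k
    using borel_measurable_simple_function[OF g(1)] by simp
  \<comment> \<open>The approximants at most double the norm, so differences of points of norm at most \<open>R\<close>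
    are sent to vectors of norm at most \<open>4 * R\<close>.\<close>
  have "bounded (f ` cball 0 (4 * R))"
    by (intro compact_imp_bounded compact_continuous_image continuous_on_subset[OF cont]) auto
  then obtain C where "\<forall>x\<in>cball 0 (4 * R). \<bar>f x\<bar> \<le> C"
    by (auto simp: bounded_iff)
  then have C: "\<bar>f x\<bar> \<le> C" if "norm x \<le> 4 * R" for x
    using that by simp
  let ?F = "\<lambda>z. w (fst z) * w (snd z) * f (fst z - snd z)"
  let ?Fk = "\<lambda>k z. w (fst z) * w (snd z) * f (g k (fst z) - g k (snd z))"
  have lim: "(\<lambda>k. \<integral>z. ?Fk k z \<partial>(lborel \<Otimes>\<^sub>M lborel)) \<longlonglongrightarrow> (\<integral>z. ?F z \<partial>(lborel \<Otimes>\<^sub>M lborel))"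
  proof (rule integral_dominated_convergence[where w = "\<lambda>z. C * (\<bar>w (fst z)\<bar> * \<bar>w (snd z)\<bar>)"])
    show "integrable (lborel \<Otimes>\<^sub>M lborel) (\<lambda>z. C * (\<bar>w (fst z)\<bar> * \<bar>w (snd z)\<bar>))"
      using w by (intro integrable_mult_right integral_product_mult(1)) auto
    show "AE z in lborel \<Otimes>\<^sub>M lborel. (\<lambda>k. ?Fk k z) \<longlonglongrightarrow> ?F z"
    proof (rule AE_I2)
      fix z :: "'a \<times> 'a"
      have "isCont f (fst z - snd z)" using cont by (simp add: continuous_on_eq_continuous_at)
      then have "(\<lambda>k. f (g k (fst z) - g k (snd z))) \<longlonglongrightarrow> f (fst z - snd z)"
        by (rule isCont_tendsto_compose) (intro tendsto_intros g)
      then show "(\<lambda>k. ?Fk k z) \<longlonglongrightarrow> ?F z" by (intro tendsto_intros)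
    qed
    show "AE z in lborel \<Otimes>\<^sub>M lborel. norm (?Fk k z) \<le> C * (\<bar>w (fst z)\<bar> * \<bar>w (snd z)\<bar>)" for k
    proof (rule AE_I2)
      fix z :: "'a \<times> 'a"
      show "norm (?Fk k z) \<le> C * (\<bar>w (fst z)\<bar> * \<bar>w (snd z)\<bar>)"
      proof (cases "norm (fst z) \<le> R \<and> norm (snd z) \<le> R")
        case True
        then have "norm (g k (fst z) - g k (snd z)) \<le> 4 * R"
          using norm_triangle_ineq4[of "g k (fst z)" "g k (snd z)"] g(3)[of k "fst z"] g(3)[of k "snd z"]
          by linarith
        from mult_left_mono[OF C[OF this], of "\<bar>w (fst z)\<bar> * \<bar>w (snd z)\<bar>"]
        show ?thesis by (simp add: abs_mult mult_ac)
      next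
        case False
        then have "w (fst z) * w (snd z) = 0" using R[of "fst z"] R[of "snd z"] by force
        then show ?thesis by (auto simp: abs_mult)
      qed
    qed
  qed measurable
  have "0 \<le> (\<integral>z. ?Fk k z \<partial>(lborel \<Otimes>\<^sub>M lborel))" for k
  proof -
    define Y where "Y = range (g k)"
    have fin: "finite Y" using g(1)[of k] by (simp add: simple_function_def Y_def)
    define u where "u a x = (w x * indicator {a} (g k x) :: real)" for a x
    define c where "c a = integral\<^sup>L lborel (u a)" for a
    have um: "integrable lborel (u a)" for a
    proof (rule Bochner_Integration.integrable_bound[OF w])
      show "u a \<in> borel_measurable lborel" unfolding u_def by measurable
      show "AE x in lborel. norm (u a x) \<le> norm (w x)" by (auto simp: u_def indicator_def)
    qed
    have eq: "?Fk k z = (\<Sum>a\<in>Y. \<Sum>b\<in>Y. f (a - b) * (u a (fst z) * u b (snd z)))" for z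
    proof -
      have "(\<Sum>a\<in>Y. \<Sum>b\<in>Y. f (a - b) * (u a (fst z) * u b (snd z))) =
        (\<Sum>a\<in>Y. if a = g k (fst z) then (\<Sum>b\<in>Y. if b = g k (snd z) then w (fst z) * w (snd z) * f (a - b) else 0) else 0)"
        by (intro sum.cong refl) (auto simp: u_def indicator_def intro!: sum.cong)
      also have "\<dots> = ?Fk k z" using fin by (simp add: sum.delta' Y_def)
      finally show ?thesis by simp
    qed
    have "(\<integral>z. ?Fk k z \<partial>(lborel \<Otimes>\<^sub>M lborel)) = (\<Sum>a\<in>Y. \<Sum>b\<in>Y. f (a - b) * (c a * c b))"
      unfolding eq c_def
      by (simp add: Bochner_Integration.integral_sum integral_product_mult[OF um um])
    also have "\<dots> = (\<Sum>a\<in>Y. \<Sum>b\<in>Y. c a * c b * f (a - b))"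
      by (simp add: mult_ac)
    also have "\<dots> \<ge> 0" by (rule double_positive_definite_quadratic_form[OF f fin])
    finally show ?thesis .
  qed
  with lim show ?thesis by (intro LIMSEQ_le_const[OF lim]) auto
qed


section \<open>The mass of differences between two sets\<close>

text \<open>The integral of \<open>f\<close> against the correlation of the indicators of \<open>P\<close> and \<open>Q\<close>. Stated as
  one integral over the product space, it allows the order of integration to be chosen freely.\<close>

definition pair_mass :: "('a::euclidean_space \<Rightarrow> real) \<Rightarrow> 'a set \<Rightarrow> 'a set \<Rightarrow> real" where
  "pair_mass f P Q =
     (\<integral>z. indicator P (fst z) * indicator Q (snd z) * f (fst z - snd z) \<partial>(lborel \<Otimes>\<^sub>M lborel))"

lemma integrable_pair_mass:
  fixes f :: "'a::euclidean_space \<Rightarrow> real"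
  assumes "continuous_on UNIV f" "compact P" "compact Q"
  shows "integrable (lborel \<Otimes>\<^sub>M lborel)
    (\<lambda>z. indicator P (fst z) * indicator Q (snd z) * f (fst z - snd z))"
  by (intro integrable_product_continuous continuous_on_compose2[OF assms(1)] continuous_intros assms) auto

lemma pair_mass_commute:
  fixes f :: "'a::euclidean_space \<Rightarrow> real"
  assumes "continuous_on UNIV f" "\<And>x. f (- x) = f x" "compact P" "compact Q"
  shows "pair_mass f P Q = pair_mass f Q P"
proof -
  have even: "f (x - y) = f (y - x)" for x y
    using assms(2)[of "x - y"] by simp
  let ?g = "\<lambda>z. indicator P (fst z) * indicator Q (snd z) * f (fst z - snd z)"
  have "(\<lambda>(x, y). ?g (y, x)) = (\<lambda>z. indicator Q (fst z) * indicator P (snd z) * f (fst z - snd z))"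
    by (auto simp: fun_eq_iff even)
  note swapped = this
  show ?thesis
    using lborel_pair.integral_product_swap[OF borel_measurable_integrable[OF integrable_pair_mass[OF assms(1,3,4)]]]
    unfolding swapped by (simp only: pair_mass_def)
qed

lemma lborel_integral_translation:
  fixes g :: "'a::euclidean_space \<Rightarrow> real"
  assumes "g \<in> borel_measurable borel"
  shows "(\<integral>x. g (c + x) \<partial>lborel) = integral\<^sup>L lborel g"
  using integral_distr[of "(+) c" lborel borel g] assms by (simp add: lborel_distr_plus)

lemma indicator_translation:
  fixes a :: "'a::ab_group_add"
  shows "indicator ((+) a ` S) x = indicator S (x - a)"
  by (auto simp: indicator_def image_iff algebra_simps) (metis add.commute diff_add_cancel)

lemma pair_mass_translation:
  fixes f :: "'a::euclidean_space \<Rightarrow> real"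
  assumes "continuous_on UNIV f" "compact P" "compact Q"
  shows "pair_mass f ((+) a ` P) ((+) a ` Q) = pair_mass f P Q"
proof -
  let ?g = "\<lambda>z. indicator P (fst z) * indicator Q (snd z) * f (fst z - snd z)"
  have m: "?g \<in> borel_measurable borel"
    using borel_measurable_integrable[OF integrable_pair_mass[OF assms]] by (simp add: lborel_prod)
  have "pair_mass f ((+) a ` P) ((+) a ` Q) = (\<integral>z. ?g ((- a, - a) + z) \<partial>lborel)"
    by (simp add: pair_mass_def lborel_prod indicator_translation)
  also have "\<dots> = pair_mass f P Q"
    unfolding lborel_integral_translation[OF m] by (simp add: pair_mass_def lborel_prod)
  finally show ?thesis .
qed

text \<open>Fubini, with the inner variable \<open>s\<close> replaced by \<open>x = s - t\<close>: the inner integral becomes that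
  of \<open>f\<close> over \<open>P - t\<close>, to which covering arguments for a fixed \<open>t\<close> apply.\<close>

lemma pair_mass_slice:
  fixes f :: "'a::euclidean_space \<Rightarrow> real"
  assumes "continuous_on UNIV f" "compact P" "compact Q"
  shows "integrable lborel (\<lambda>t. indicator Q t * (\<integral>x. indicator P (t + x) * f x \<partial>lborel))"
    and "pair_mass f P Q = (\<integral>t. indicator Q t * (\<integral>x. indicator P (t + x) * f x \<partial>lborel) \<partial>lborel)"
proof -
  have [measurable]: "f \<in> borel_measurable borel" "P \<in> sets borel"
    using assms by (auto intro: borel_measurable_continuous_onI borel_compact)
  have shift: "(\<integral>s. indicator P s * f (s - t) \<partial>lborel) = (\<integral>x. indicator P (t + x) * f x \<partial>lborel)" for t
    using lborel_integral_translation[of "\<lambda>s. indicator P s * f (s - t)" t] by simp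
  have "integrable lborel (\<lambda>t. (\<integral>s. indicator P s * indicator Q t * f (s - t) \<partial>lborel))"
    using lborel_pair.integrable_snd[of "\<lambda>s t. indicator P s * indicator Q t * f (s - t)"]
      integrable_pair_mass[OF assms] by (simp add: case_prod_unfold)
  moreover have "(\<integral>t. (\<integral>s. indicator P s * indicator Q t * f (s - t) \<partial>lborel) \<partial>lborel) = pair_mass f P Q"
    using lborel_pair.integral_snd[of "\<lambda>s t. indicator P s * indicator Q t * f (s - t)"]
      integrable_pair_mass[OF assms] by (simp add: case_prod_unfold pair_mass_def)
  moreover have "(\<integral>s. indicator P s * indicator Q t * f (s - t) \<partial>lborel) =
      indicator Q t * (\<integral>x. indicator P (t + x) * f x \<partial>lborel)" for t
  proof -
    have "(\<integral>s. indicator P s * indicator Q t * f (s - t) \<partial>lborel) =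
        (\<integral>s. indicator Q t * (indicator P s * f (s - t)) \<partial>lborel)"
      by (simp only: mult_ac)
    also have "\<dots> = indicator Q t * (\<integral>s. indicator P s * f (s - t) \<partial>lborel)"
      by (rule integral_mult_right_zero)
    finally show ?thesis by (simp only: shift)
  qed
  ultimately show "integrable lborel (\<lambda>t. indicator Q t * (\<integral>x. indicator P (t + x) * f x \<partial>lborel))"
    "pair_mass f P Q = (\<integral>t. indicator Q t * (\<integral>x. indicator P (t + x) * f x \<partial>lborel) \<partial>lborel)"
    by simp_all
qed

lemma integrable_indicator_compact:
  fixes S :: "'a::euclidean_space set"
  assumes "compact S"
  shows "integrable lborel (indicator S :: 'a \<Rightarrow> real)"
  using borel_integrable_compact[OF assms, of "\<lambda>_. 1 :: real"] by simp

text \<open>The quadratic form of \<open>f\<close> at the density \<open>1\<^sub>P - 1\<^sub>Q\<close> with \<open>Q = a + P\<close> expands into four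
  masses. The two diagonal ones agree by translation invariance and the two mixed ones by symmetry,
  so its nonnegativity is twice the claim.\<close>

lemma pair_mass_translate_le:
  fixes f :: "'a::euclidean_space \<Rightarrow> real"
  assumes f: "double_positive_definite f" and P: "compact P"
  shows "pair_mass f ((+) a ` P) P \<le> pair_mass f P P"
proof -
  have cont: "continuous_on UNIV f" by (rule double_positive_definite_continuous[OF f])
  define Q where "Q = (+) a ` P"
  have Q: "compact Q" unfolding Q_def using P by (simp add: compact_translation)
  define w :: "'a \<Rightarrow> real" where "w x = indicator P x - indicator Q x" for x
  have "bounded (P \<union> Q)" using P Q by (auto dest: compact_imp_bounded)
  then obtain R where R: "\<And>x. x \<in> P \<union> Q \<Longrightarrow> norm x \<le> R" by (auto simp: bounded_iff)
  have wR: "w x = 0" if "R < norm x" for x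
    using R[of x] that by (auto simp: w_def indicator_def)
  have "integrable lborel w"
    unfolding w_def
    by (intro Bochner_Integration.integrable_diff integrable_indicator_compact P Q)
  from integral_quadratic_form_nonneg[OF f this wR]
  have "0 \<le> (\<integral>z. w (fst z) * w (snd z) * f (fst z - snd z) \<partial>(lborel \<Otimes>\<^sub>M lborel))" by simp
  also have "\<dots> = pair_mass f P P - pair_mass f P Q - pair_mass f Q P + pair_mass f Q Q"
    unfolding pair_mass_def w_def using integrable_pair_mass[OF cont] P Q
    by (simp add: left_diff_distrib right_diff_distrib)
  also have "pair_mass f P Q = pair_mass f Q P"
    by (rule pair_mass_commute[OF cont double_positive_definite_even[OF f] P Q])
  also have "pair_mass f Q Q = pair_mass f P P"
    unfolding Q_def by (rule pair_mass_translation[OF cont P P])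
  finally show ?thesis by (simp add: Q_def)
qed

section \<open>Comparing integrals through a covering\<close>

text \<open>Both \<open>|H|\<close> times the left side and \<open>|H|\<close> times the right side are compared with the masses of
  the pairs \<open>a + H\<close>, \<open>H\<close>. In the slice at \<open>t\<close>, the sets \<open>a + H - t\<close> cover \<open>V\<close>, which bounds the
  sum of these masses from below. By positive definiteness no mass exceeds the one for \<open>a = 0\<close>, and
  the slices of that one lie in \<open>U\<close>.\<close>

lemma integral_le_card_mult_integral:
  fixes f :: "'a::euclidean_space \<Rightarrow> real"
  assumes f: "double_positive_definite f"
    and U: "compact U" and V: "compact V" and H: "compact H" "0 < measure lborel H"
    and HU: "\<And>s t. s \<in> H \<Longrightarrow> t \<in> H \<Longrightarrow> s - t \<in> U"
    and Y: "finite Y" and cover: "\<And>x t. x \<in> V \<Longrightarrow> t \<in> H \<Longrightarrow> \<exists>a\<in>Y. t + x - a \<in> H"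
  shows "(\<integral>x. indicator V x * f x \<partial>lborel) \<le> card Y * (\<integral>x. indicator U x * f x \<partial>lborel)"
proof -
  have cont: "continuous_on UNIV f" by (rule double_positive_definite_continuous[OF f])
  have f0: "0 \<le> f x" for x using f by (simp add: double_positive_definite_def)
  have int: "integrable lborel (\<lambda>x. indicator S x * f x)" if "compact S" for S
    using borel_integrable_compact[OF that continuous_on_subset[OF cont]] by simp
  have Ha: "compact ((+) a ` H)" for a using H by (simp add: compact_translation)
  have shift: "(\<lambda>x. indicator S (t + x) * f x) = (\<lambda>x. indicator ((+) (- t) ` S) x * f x)" for S t
    unfolding indicator_translation by (simp add: add.commute)
  have intshift: "integrable lborel (\<lambda>x. indicator S (t + x) * f x)" if "compact S" for S t
    unfolding shift by (rule int[OF compact_translation[OF that]])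
  let ?IV = "\<integral>x. indicator V x * f x \<partial>lborel" and ?IU = "\<integral>x. indicator U x * f x \<partial>lborel"
  let ?J = "\<lambda>S t. \<integral>x. indicator S (t + x) * f x \<partial>lborel"
  have HI: "(\<integral>t. indicator H t * c \<partial>lborel) = measure lborel H * c" for c :: real
    by simp
  have Hint: "integrable lborel (\<lambda>t. indicator H t * c)" for c :: real
    by (intro integrable_mult_left integrable_indicator_compact H(1))
  have self: "pair_mass f H H \<le> measure lborel H * ?IU"
  proof -
    have "pair_mass f H H = (\<integral>t. indicator H t * ?J H t \<partial>lborel)"
      by (rule pair_mass_slice(2)[OF cont H(1) H(1)])
    also have "\<dots> \<le> (\<integral>t. indicator H t * ?IU \<partial>lborel)"
    proof (rule integral_mono)
      show "integrable lborel (\<lambda>t. indicator H t * ?J H t)"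
        by (rule pair_mass_slice(1)[OF cont H(1) H(1)])
      show "integrable lborel (\<lambda>t. indicator H t * ?IU)" by (rule Hint)
      fix t
      have "?J H t \<le> ?IU" if "t \<in> H"
      proof (rule integral_mono[OF intshift[OF H(1)] int[OF U]])
        fix x
        show "indicator H (t + x) * f x \<le> indicator U x * f x"
          using HU[OF _ that, of "t + x"] f0[of x] by (auto simp: indicator_def)
      qed
      then show "indicator H t * ?J H t \<le> indicator H t * ?IU"
        by (auto simp: indicator_def)
    qed
    also have "\<dots> = measure lborel H * ?IU" by (simp only: HI)
    finally show ?thesis .
  qed
  have "measure lborel H * ?IV = (\<integral>t. indicator H t * ?IV \<partial>lborel)" by (simp only: HI)
  also have "\<dots> \<le> (\<integral>t. (\<Sum>a\<in>Y. indicator H t * ?J ((+) a ` H) t) \<partial>lborel)"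
  proof (rule integral_mono)
    show "integrable lborel (\<lambda>t. indicator H t * ?IV)" by (rule Hint)
    show "integrable lborel (\<lambda>t. \<Sum>a\<in>Y. indicator H t * ?J ((+) a ` H) t)"
      by (intro Bochner_Integration.integrable_sum pair_mass_slice(1)[OF cont Ha H(1)])
    fix t
    show "indicator H t * ?IV \<le> (\<Sum>a\<in>Y. indicator H t * ?J ((+) a ` H) t)"
    proof (cases "t \<in> H")
      case True
      have "?IV \<le> (\<integral>x. (\<Sum>a\<in>Y. indicator ((+) a ` H) (t + x) * f x) \<partial>lborel)"
      proof (rule integral_mono)
        show "integrable lborel (\<lambda>x. indicator V x * f x)" by (rule int[OF V])
        show "integrable lborel (\<lambda>x. \<Sum>a\<in>Y. indicator ((+) a ` H) (t + x) * f x)"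
          by (intro Bochner_Integration.integrable_sum intshift Ha)
        fix x
        have nn: "0 \<le> indicator ((+) a ` H) (t + x) * f x" for a by (simp add: f0)
        show "indicator V x * f x \<le> (\<Sum>a\<in>Y. indicator ((+) a ` H) (t + x) * f x)"
        proof (cases "x \<in> V")
          case x: True
          obtain a where a: "a \<in> Y" "t + x - a \<in> H" using cover[OF x True] by blast
          have "indicator V x * f x = indicator ((+) a ` H) (t + x) * f x"
            using x a by (simp add: indicator_translation)
          also have "\<dots> \<le> (\<Sum>a\<in>Y. indicator ((+) a ` H) (t + x) * f x)"
            by (rule member_le_sum[OF a(1)]) (use Y nn in auto)
          finally show ?thesis .
        qed (use nn in \<open>simp add: sum_nonneg\<close>)
      qed
      also have "\<dots> = (\<Sum>a\<in>Y. ?J ((+) a ` H) t)"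
        by (rule Bochner_Integration.integral_sum) (rule intshift[OF Ha])
      finally show ?thesis using True by simp
    qed simp
  qed
  also have "\<dots> = (\<Sum>a\<in>Y. pair_mass f ((+) a ` H) H)"
    by (subst Bochner_Integration.integral_sum)
      (simp_all add: pair_mass_slice[OF cont Ha H(1)])
  also have "\<dots> \<le> (\<Sum>a\<in>Y. pair_mass f H H)"
    by (intro sum_mono pair_mass_translate_le[OF f H(1)])
  also have "\<dots> = card Y * pair_mass f H H" by simp
  also have "\<dots> \<le> card Y * (measure lborel H * ?IU)"
    by (intro mult_left_mono self) simp
  finally have "measure lborel H * ?IV \<le> measure lborel H * (card Y * ?IU)"
    by (simp only: mult_ac)
  then show ?thesis using H(2) by simp
qed

text \<open>Every translate of \<open>X\<close> by some \<open>\<tau>\<close> is also a covering set, and only its points in \<open>K\<close> matter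
  for covering \<open>V\<close>. Integrating the resulting inequalities over \<open>\<tau>\<close> in a ball of radius \<open>R\<close>
  replaces the number of these points by a sum of volumes of translates of \<open>K\<close>, one for each point
  of \<open>X\<close> that can be moved into \<open>K\<close>; such points have norm at most \<open>R + \<rho>\<close>.\<close>

lemma integral_le_average:
  fixes f :: "'a::euclidean_space \<Rightarrow> real"
  assumes f: "double_positive_definite f"
    and U: "compact U" and V: "compact V" and H: "compact H" "0 < measure lborel H"
    and HU: "\<And>s t. s \<in> H \<Longrightarrow> t \<in> H \<Longrightarrow> s - t \<in> U"
    and K: "compact K" "K \<subseteq> cball 0 \<rho>" and VK: "\<And>x y. x \<in> V \<Longrightarrow> y \<in> U \<Longrightarrow> x + y \<in> K"
    and X: "UNIV \<subseteq> H + X" and fin: "finite (X \<inter> cball 0 (R + \<rho>))"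
  shows "measure lborel (cball (0::'a) R) * (\<integral>x. indicator V x * f x \<partial>lborel) \<le>
    card (X \<inter> cball 0 (R + \<rho>)) * measure lborel K * (\<integral>x. indicator U x * f x \<partial>lborel)"
proof -
  have f0: "0 \<le> f x" for x using f by (simp add: double_positive_definite_def)
  have [measurable]: "K \<in> sets borel" using K by (auto intro: borel_compact)
  define Z where "Z = X \<inter> cball 0 (R + \<rho>)"
  have finZ: "finite Z" using fin by (simp add: Z_def)
  let ?IV = "\<integral>x. indicator V x * f x \<partial>lborel" and ?IU = "\<integral>x. indicator U x * f x \<partial>lborel"
  have IU: "0 \<le> ?IU" by (intro integral_nonneg_AE AE_I2) (simp add: f0)
  have intK: "integrable lborel (\<lambda>\<tau>. indicator K (x + \<tau>) :: real)" for x :: 'a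
  proof -
    have "integrable lborel (indicator ((+) (- x) ` K) :: 'a \<Rightarrow> real)"
      by (intro integrable_indicator_compact compact_translation K(1))
    moreover have "(indicator ((+) (- x) ` K) :: 'a \<Rightarrow> real) = (\<lambda>\<tau>. indicator K (x + \<tau>))"
      unfolding indicator_translation fun_eq_iff by (simp add: add.commute)
    ultimately show ?thesis by simp
  qed
  have local: "?IV \<le> (\<Sum>x\<in>Z. indicator K (x + \<tau>)) * ?IU" if \<tau>: "\<tau> \<in> cball 0 R" for \<tau>
  proof -
    define Y where "Y = (\<lambda>x. x + \<tau>) ` {x \<in> Z. x + \<tau> \<in> K}"
    have finY: "finite Y" using finZ by (simp add: Y_def)
    have cov: "\<exists>a\<in>Y. t + x - a \<in> H" if x: "x \<in> V" and t: "t \<in> H" for x t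
    proof -
      obtain h b where hb: "t + x - \<tau> = h + b" "h \<in> H" "b \<in> X"
        using X by (meson UNIV_I set_plus_elim subsetD)
      have "x + (t - h) \<in> K" using VK[OF x HU[OF t hb(2)]] .
      moreover have "x + (t - h) = b + \<tau>" using hb(1) by (simp add: algebra_simps)
      ultimately have bK: "b + \<tau> \<in> K" by simp
      then have "norm (b + \<tau>) \<le> \<rho>" using K(2) by auto
      then have "norm b \<le> R + \<rho>" using \<tau> norm_triangle_ineq4[of "b + \<tau>" \<tau>] by simp
      then have "b + \<tau> \<in> Y" using hb(3) bK by (simp add: Y_def Z_def)
      moreover have "t + x - (b + \<tau>) \<in> H" using hb by (simp add: algebra_simps)
      ultimately show ?thesis by blast
    qed
    have "?IV \<le> card Y * ?IU"
      by (rule integral_le_card_mult_integral[OF f U V H HU finY cov])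
    also have "real (card Y) = (\<Sum>x\<in>Z. indicator K (x + \<tau>))"
    proof -
      have "card Y = card {x \<in> Z. x + \<tau> \<in> K}"
        unfolding Y_def by (intro card_image) (simp add: inj_on_def)
      then show ?thesis using finZ
        by (simp add: indicator_def sum.If_cases Int_def)
    qed
    finally show ?thesis .
  qed
  have "measure lborel (cball (0::'a) R) * ?IV = (\<integral>\<tau>. indicator (cball (0::'a) R) \<tau> * ?IV \<partial>lborel)"
    by simp
  also have "\<dots> \<le> (\<integral>\<tau>. (\<Sum>x\<in>Z. indicator K (x + \<tau>)) * ?IU \<partial>lborel)"
  proof (rule integral_mono)
    show "integrable lborel (\<lambda>\<tau>. indicator (cball (0::'a) R) \<tau> * ?IV)"
      by (intro integrable_mult_left integrable_indicator_compact compact_cball)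
    show "integrable lborel (\<lambda>\<tau>. (\<Sum>x\<in>Z. indicator K (x + \<tau>)) * ?IU)"
      by (intro integrable_mult_left Bochner_Integration.integrable_sum intK)
    fix \<tau> :: 'a
    show "indicator (cball 0 R) \<tau> * ?IV \<le> (\<Sum>x\<in>Z. indicator K (x + \<tau>)) * ?IU"
      using local[of \<tau>] IU by (cases "\<tau> \<in> cball 0 R") (auto intro!: mult_nonneg_nonneg sum_nonneg)
  qed
  also have "\<dots> = (\<Sum>x\<in>Z. \<integral>\<tau>. indicator K (x + \<tau>) \<partial>lborel) * ?IU"
    by (simp add: Bochner_Integration.integral_sum[OF intK])
  also have "\<dots> = card Z * measure lborel K * ?IU"
    by (simp add: lborel_integral_translation)
  finally show ?thesis by (simp add: Z_def)
qed

section \<open>Passing to the covering density\<close>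

lemma inradius_cball:
  assumes "0 \<le> R"
  shows "inradius (cball (0::'a::euclidean_space) R) = R"
  unfolding inradius_def
proof (rule cSup_eq_maximum)
  show "R \<in> {r. 0 \<le> r \<and> (\<exists>x::'a. cball x r \<subseteq> cball 0 R)}" using assms by auto
  show "r \<le> R" if "r \<in> {r. 0 \<le> r \<and> (\<exists>x::'a. cball x r \<subseteq> cball 0 R)}" for r
    using that by (auto simp: cball_subset_cball_iff)
       (metis add.commute add_increasing2 order_trans zero_le_dist norm_ge_zero le_add_same_cancel1 )
qed

text \<open>Centred balls are the only convex bodies along which the density asymptotics is used.\<close>

lemma filterlim_cball_large_convex_bodies:
  "filterlim (cball (0::'a::euclidean_space)) large_convex_bodies at_top"
  unfolding large_convex_bodies_def filterlim_inf filterlim_principal filterlim_filtercomap_iff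
proof
  have "eventually (\<lambda>R. R = (inradius \<circ> cball (0::'a)) R) at_top"
    using eventually_ge_at_top[of 0] by eventually_elim (simp add: inradius_cball)
  then show "filterlim (inradius \<circ> cball (0::'a)) at_top at_top"
    by (rule filterlim_cong[THEN iffD1, OF refl refl]) (rule filterlim_ident)
  show "eventually (\<lambda>R. cball (0::'a) R \<in> {A. convex_body A}) at_top"
    using eventually_gt_at_top[of 0] by eventually_elim (auto simp: convex_body_def)
qed

lemma has_covering_density_cball:
  fixes H :: "'a::euclidean_space set"
  assumes "has_covering_density H X d"
  shows "\<forall>\<^sub>F S in at_top. finite (X \<inter> cball 0 S)"
    and "((\<lambda>S. real (card (X \<inter> cball 0 S)) * vol H / vol (cball (0::'a) S)) \<longlongrightarrow> d) at_top"
proof -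
  have "\<forall>\<^sub>F A in large_convex_bodies. finite (X \<inter> A)"
    and asymp: "(\<lambda>A. real (card (X \<inter> A)) * vol H / vol A) \<sim>[large_convex_bodies] (\<lambda>_. d)"
    using assms by (simp_all add: has_covering_density_def)
  then show "\<forall>\<^sub>F S in at_top. finite (X \<inter> cball 0 S)"
    using filterlim_cball_large_convex_bodies by (auto simp: filterlim_iff)
  show "((\<lambda>S. real (card (X \<inter> cball 0 S)) * vol H / vol (cball (0::'a) S)) \<longlongrightarrow> d) at_top"
    by (rule asymp_equivD_const[OF asymp_equiv_compose'[OF asymp filterlim_cball_large_convex_bodies]])
qed

lemma has_covering_density_nonneg:
  fixes H :: "'a::euclidean_space set"
  assumes "has_covering_density H X d"
  shows "0 \<le> d"
  by (rule tendsto_lowerbound[OF has_covering_density_cball(2)[OF assms]]) simp_all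

lemma compact_set_plus:
  fixes A B :: "'a::real_normed_vector set"
  assumes "compact A" "compact B"
  shows "compact (A + B)"
proof -
  have "A + B = {x + y | x y. x \<in> A \<and> y \<in> B}" by (auto simp: set_plus_def)
  then show ?thesis using compact_sums[OF assms] by simp
qed

text \<open>The averaged inequality for radius \<open>S - \<rho>\<close> counts the points of \<open>X\<close> in the ball of radius
  \<open>S\<close>. As \<open>S\<close> grows, the ratio \<open>(1 - \<rho> / S) ^ n\<close> of the volumes of the two balls tends to \<open>1\<close>,
  while the normalised count tends to the density \<open>d\<close>.\<close>

lemma integral_le_covering_density:
  fixes f :: "'a::euclidean_space \<Rightarrow> real"
  assumes f: "double_positive_definite f"
    and U: "compact U" and V: "compact V" and H: "compact H" "0 < measure lborel H"
    and HU: "\<And>s t. s \<in> H \<Longrightarrow> t \<in> H \<Longrightarrow> s - t \<in> U"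
    and d: "has_covering_density H X d"
  shows "measure lborel H * (\<integral>x. indicator V x * f x \<partial>lborel) \<le>
    d * measure lborel (V + U) * (\<integral>x. indicator U x * f x \<partial>lborel)"
proof -
  let ?IV = "\<integral>x. indicator V x * f x \<partial>lborel" and ?IU = "\<integral>x. indicator U x * f x \<partial>lborel"
  have K: "compact (V + U)"
    by (rule compact_set_plus[OF V U])
  obtain \<rho> where "\<forall>x\<in>V + U. norm x \<le> \<rho>"
    using compact_imp_bounded[OF K] unfolding bounded_iff ..
  then have \<rho>: "V + U \<subseteq> cball 0 \<rho>" by auto
  define \<beta> where "\<beta> = unit_ball_vol (real DIM('a))"
  have \<beta>: "0 < \<beta>" by (simp add: \<beta>_def)
  have ball: "measure lborel (cball (0::'a) S) = \<beta> * S ^ DIM('a)" if "0 \<le> S" for S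
    using content_cball[OF that, of "0::'a"] by (simp add: \<beta>_def)
  define q where "q S = real (card (X \<inter> cball 0 S)) * vol H / vol (cball (0::'a) S)" for S
  have q: "(q \<longlongrightarrow> d) at_top"
    using has_covering_density_cball(2)[OF d] by (simp add: q_def[abs_def])
  have fin: "\<forall>\<^sub>F S in at_top. finite (X \<inter> cball 0 S)"
    by (rule has_covering_density_cball(1)[OF d])
  have lim1: "((\<lambda>S. measure lborel H * ?IV * (1 - \<rho> / S) ^ DIM('a)) \<longlongrightarrow>
      measure lborel H * ?IV * (1 - 0) ^ DIM('a)) at_top"
    by (intro tendsto_intros tendsto_divide_0[OF tendsto_const]
        filterlim_mono[OF filterlim_ident at_top_le_at_infinity order_refl])
  have lim2: "((\<lambda>S. q S * measure lborel (V + U) * ?IU) \<longlongrightarrow> d * measure lborel (V + U) * ?IU) at_top"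
    by (intro tendsto_intros q)
  have ev: "\<forall>\<^sub>F S in at_top. measure lborel H * ?IV * (1 - \<rho> / S) ^ DIM('a) \<le> q S * measure lborel (V + U) * ?IU"
    using fin eventually_gt_at_top[of 0] eventually_gt_at_top[of \<rho>]
  proof eventually_elim
    case (elim S)
    have "measure lborel (cball (0::'a) (S - \<rho>)) * ?IV \<le>
      card (X \<inter> cball 0 (S - \<rho> + \<rho>)) * measure lborel (V + U) * ?IU"
      by (rule integral_le_average[OF f U V H HU K \<rho>])
        (use d elim in \<open>auto simp: has_covering_density_def\<close>)
    then have "\<beta> * (S - \<rho>) ^ DIM('a) * ?IV \<le> card (X \<inter> cball 0 S) * measure lborel (V + U) * ?IU"
      using elim by (simp add: ball)
    from mult_left_mono[OF this, of "measure lborel H / (\<beta> * S ^ DIM('a))"]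
    have "measure lborel H / (\<beta> * S ^ DIM('a)) * (\<beta> * (S - \<rho>) ^ DIM('a) * ?IV) \<le>
       measure lborel H / (\<beta> * S ^ DIM('a)) * (card (X \<inter> cball 0 S) * measure lborel (V + U) * ?IU)"
      using \<beta> elim by simp
    also have "measure lborel H / (\<beta> * S ^ DIM('a)) * (\<beta> * (S - \<rho>) ^ DIM('a) * ?IV) =
        measure lborel H * ?IV * ((S - \<rho>) / S) ^ DIM('a)"
      using \<beta> elim by (simp add: power_divide)
    also have "(S - \<rho>) / S = 1 - \<rho> / S" using elim by (simp add: diff_divide_distrib)
    also have "measure lborel H / (\<beta> * S ^ DIM('a)) * (card (X \<inter> cball 0 S) * measure lborel (V + U) * ?IU) =
        q S * measure lborel (V + U) * ?IU"
      using elim H(1) by (simp add: q_def ball borel_compact)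
    finally show ?case .
  qed
  from tendsto_le[OF _ lim2 lim1 ev] show ?thesis by simp
qed


section \<open>Dilates of convex bodies\<close>

lemma vol_dilate:
  fixes A :: "'a::euclidean_space set"
  assumes "0 \<le> c"
  shows "vol (dilate c A) = c ^ DIM('a) * vol A"
  using measure_lebesgue_affine[of c 0 A] assms by (simp add: dilate_def)

lemma convex_body_vol_pos:
  assumes "convex_body A"
  shows "0 < vol A"
proof -
  have "\<not> negligible A"
    using assms negligible_convex_interior by (auto simp: convex_body_def)
  moreover have "A \<in> lmeasurable"
    using assms by (auto simp: convex_body_def intro: lmeasurable_compact)
  ultimately show ?thesis
    by (metis negligible_iff_measure measure_nonneg order_le_less)
qed

lemma convex_body_dilate:
  assumes "convex_body A" "0 < c"
  shows "convex_body (dilate c A)"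
proof -
  have "interior (dilate c A) = dilate c (interior A)"
    unfolding dilate_def
    by (rule interior_injective_linear_image) (use assms in \<open>auto simp: inj_on_def\<close>)
  then show ?thesis
    using assms by (auto simp: convex_body_def dilate_def intro: compact_scaling convex_scaling)
qed

text \<open>Convexity enters through \<open>r a + b = (1 + r) (r / (1 + r) a + 1 / (1 + r) b)\<close>.\<close>

lemma dilate_plus_convex:
  assumes "convex A" "0 \<le> r"
  shows "dilate r A + A = dilate (1 + r) A"
proof (intro equalityI subsetI)
  fix x assume "x \<in> dilate r A + A"
  then obtain a b where ab: "a \<in> A" "b \<in> A" "x = r *\<^sub>R a + b"
    by (auto simp: set_plus_def dilate_def)
  have "(r / (1 + r)) *\<^sub>R a + (1 / (1 + r)) *\<^sub>R b \<in> A"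
    using assms ab by (intro convexD) (auto simp: add_divide_distrib[symmetric] add.commute)
  moreover have "x = (1 + r) *\<^sub>R ((r / (1 + r)) *\<^sub>R a + (1 / (1 + r)) *\<^sub>R b)"
    using assms ab by (simp add: scaleR_add_right)
  ultimately show "x \<in> dilate (1 + r) A" by (auto simp: dilate_def)
next
  fix x assume "x \<in> dilate (1 + r) A"
  then obtain a where "a \<in> A" "x = r *\<^sub>R a + a"
    by (auto simp: dilate_def scaleR_add_left add.commute)
  then show "x \<in> dilate r A + A" by (auto simp: dilate_def)
qed

lemma convex_symmetric_half_diff:
  assumes "convex U" "zero_symmetric U" "s \<in> dilate (1 / 2) U" "t \<in> dilate (1 / 2) U"
  shows "s - t \<in> U"
proof -
  obtain a b where ab: "a \<in> U" "b \<in> U" "s = (1 / 2) *\<^sub>R a" "t = (1 / 2) *\<^sub>R b"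
    using assms(3,4) by (auto simp: dilate_def)
  have "- b \<in> U" using assms(2) ab(2) unfolding zero_symmetric_def by blast
  with ab(1) have "(1 / 2) *\<^sub>R a + (1 / 2) *\<^sub>R (- b) \<in> U"
    by (intro convexD[OF assms(1)]) auto
  then show ?thesis using ab by simp
qed

section \<open>The bound on the Wiener constant\<close>

lemma set_integral_lebesgue_continuous:
  fixes f :: "'a::euclidean_space \<Rightarrow> real"
  assumes "continuous_on UNIV f" "compact S"
  shows "(LINT x:S|lebesgue. f x) = (\<integral>x. indicator S x * f x \<partial>lborel)"
proof -
  have [measurable]: "f \<in> borel_measurable borel" "S \<in> sets borel"
    using assms by (auto intro: borel_measurable_continuous_onI borel_compact)
  have "(\<lambda>x. indicator S x * f x) \<in> borel_measurable lborel" by measurable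
  then show ?thesis
    by (simp add: set_lebesgue_integral_def integral_completion)
qed

text \<open>For a single admissible \<open>f\<close> and a single covering set of density \<open>d\<close> the bound is the integral
  comparison above, rewritten with \<open>|H| = |U| / 2\<^sup>n\<close>. The positive factor in front then moves
  through the infimum over all densities, including the case of an empty set of densities, where
  the infimum is \<open>\<infinity>\<close>.\<close>

theorem wiener_const_le_covering_density:
  fixes U V :: "'a::euclidean_space set"
  assumes U: "convex_body U" "zero_symmetric U" and V: "convex_body V"
  shows "wiener_const U V \<le>
    ereal (2 ^ DIM('a) * (vol (V + U) / vol V)) * min_covering_density (dilate (1 / 2) U)"
proof -
  let ?H = "dilate (1 / 2) U"
  define c where "c = 2 ^ DIM('a) * (vol (V + U) / vol V)"
  have vU: "0 < vol U" and vV: "0 < vol V" using U V by (auto intro: convex_body_vol_pos)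
  have comp: "compact U" "compact V" using U V by (auto simp: convex_body_def)
  have H: "convex_body ?H" by (rule convex_body_dilate[OF U(1)]) simp
  then have cH: "compact ?H" by (simp add: convex_body_def)
  have vH: "vol ?H = vol U / 2 ^ DIM('a)" by (simp add: vol_dilate power_divide)
  have cK: "compact (V + U)"
    by (rule compact_set_plus[OF comp(2,1)])
  \<comment> \<open>Positivity of \<open>|V + U|\<close> is needed to move the factor through an infimum in the extended reals.\<close>
  obtain u where u: "u \<in> U" using vU by fastforce
  have "vol V = vol ((+) u ` V)" by (simp add: measure_translation)
  also have "\<dots> \<le> vol (V + U)"
  proof (rule measure_mono_fmeasurable)
    show "(+) u ` V \<subseteq> V + U" using u by (auto simp: set_plus_def add.commute)
    show "(+) u ` V \<in> sets lebesgue" 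
      by (intro fmeasurableD lmeasurable_compact compact_translation comp)
    show "V + U \<in> lmeasurable" by (intro lmeasurable_compact cK)
  qed
  finally have vK: "0 < vol (V + U)" using vV by simp
  have c: "0 < c" using vV vK by (simp add: c_def)
  have bound: "wiener_const U V \<le> ereal c * ereal d" if d: "has_covering_density ?H X d" for X d
    unfolding wiener_const_def
  proof (rule SUP_least)
    fix f :: "'a \<Rightarrow> real" assume "f \<in> {f. double_positive_definite f \<and> f \<noteq> (\<lambda>x. 0)}"
    then have f: "double_positive_definite f" by simp
    note cont = double_positive_definite_continuous[OF f]
    let ?IV = "LINT x:V|lebesgue. f x" and ?IU = "LINT x:U|lebesgue. f x"
    have "0 < measure lborel ?H"
      using convex_body_vol_pos[OF H] cH by (simp add: borel_compact)
    from integral_le_covering_density[OF f comp cH this convex_symmetric_half_diff[OF _ U(2)] d] U(1)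
    have "vol ?H * ?IV \<le> d * vol (V + U) * ?IU"
      using cH cK
      by (simp add: convex_body_def borel_compact set_integral_lebesgue_continuous[OF cont] comp)
    from mult_left_mono[OF this, of "2 ^ DIM('a)"]
    have le: "vol U * ?IV \<le> 2 ^ DIM('a) * d * vol (V + U) * ?IU"
      by (simp add: vH mult_ac)
    have IU0: "0 \<le> ?IU" unfolding set_integral_lebesgue_continuous[OF cont comp(1)]
      using f by (intro integral_nonneg_AE AE_I2) (simp add: double_positive_definite_def)
    have "(1 / vol V * ?IV) / (1 / vol U * ?IU) \<le> c * d"
    proof (cases "?IU = 0")
      \<comment> \<open>The quotient is then \<open>0\<close> by the convention for division by zero.\<close>
      case True
      then show ?thesis using c has_covering_density_nonneg[OF d] by simp
    next
      case False
      then show ?thesis using le IU0 vU vV by (simp add: c_def field_simps)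
    qed
    then show "ereal ((1 / vol V * ?IV) / (1 / vol U * ?IU)) \<le> ereal c * ereal d" by simp
  qed
  have "wiener_const U V \<le> Inf {ereal c * x |x. \<exists>X d. x = ereal d \<and> has_covering_density ?H X d}"
    by (rule Inf_greatest) (use bound in blast)
  also have "\<dots> = ereal c * min_covering_density ?H"
    unfolding min_covering_density_def by (rule ereal_Inf_cmult[OF c])
  finally show ?thesis by (simp add: c_def)
qed

text \<open>The second bound is the first one for \<open>V = r U\<close>, because \<open>r U + U = (1 + r) U\<close> has volume
  \<open>(1 + r)\<^sup>n |U|\<close>.\<close>

theorem corollary1:
  fixes U V H :: "(real ^ 'n) set"
  assumes "convex_body U" "zero_symmetric U"
    and "convex_body V" "zero_symmetric V"
    and "H = dilate (1 / 2) U"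
  shows "wiener_const U V \<le>
           ereal (2 ^ CARD('n) * (vol (V + U) / vol V)) * min_covering_density H \<and>
         (\<forall>r\<ge>1. wiener_const U (dilate r U) \<le>
           ereal (2 ^ CARD('n) * (1 + 1 / r) ^ CARD('n)) * min_covering_density H)"
proof (intro conjI allI impI)
  show "wiener_const U V \<le>
      ereal (2 ^ CARD('n) * (vol (V + U) / vol V)) * min_covering_density H"
    using wiener_const_le_covering_density[OF assms(1-3)] assms(5) by simp
next
  fix r :: real assume r: "1 \<le> r"
  have "vol U \<noteq> 0" using convex_body_vol_pos[OF assms(1)] by simp
  moreover have "convex U" using assms(1) by (simp add: convex_body_def)
  ultimately have "vol (dilate r U + U) / vol (dilate r U) = (1 + r) ^ CARD('n) / r ^ CARD('n)"
    using r by (simp add: dilate_plus_convex vol_dilate)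
  also have "\<dots> = (1 + 1 / r) ^ CARD('n)"
    using r by (simp add: power_divide[symmetric] add_divide_distrib add.commute)
  finally have ratio: "vol (dilate r U + U) / vol (dilate r U) = (1 + 1 / r) ^ CARD('n)" .
  have "convex_body (dilate r U)" by (rule convex_body_dilate[OF assms(1)]) (use r in simp)
  from wiener_const_le_covering_density[OF assms(1,2) this]
  show "wiener_const U (dilate r U) \<le>
      ereal (2 ^ CARD('n) * (1 + 1 / r) ^ CARD('n)) * min_covering_density H"
    using assms(5) by (simp add: ratio)
qed

end
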